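(* Let $W \in L(\mathcal{H})^+$ and let $\mathcal{S} \subseteq \mathcal{H}$ be a closed subspace. Then the pair $(W, N(W_{/\mathcal{S}}))$ is compatible if and only if $$W_{/\mathcal{S}} = \max_{\overset{-}{\leq}}\ \mathcal{M}^{-}(W,\mathcal{S}),$$ i.e. $W_{/\mathcal{S}} \in \mathcal{M}^{-}(W,\mathcal{S})$ and $X \overset{-}{\leq} W_{/\mathcal{S}}$ for every $X \in \mathcal{M}^{-}(W,\mathcal{S})$.
   Context: $\mathcal{H}$ is a separable complex Hilbert space, $L(\mathcal{H})$ the algebra of bounded linear operators on $\mathcal{H}$, $L(\mathcal{H})^+$ the cone of positive semidefinite operators, and $\leq$ the order induced by this cone. $R(T)$ and $N(T)$ denote range and nullspace of $T$. Shorted operator: for $W\in L(\mathcal{H})^+$ and a closed subspace $\mathcal{S}$, $W_{/\mathcal{S}}$ is the maximum, with respect to $\leq$ (known to exist), of the set $\{X\in L(\mathcal{H}): 0\leq X\leq W,\ R(X)\subseteq \mathcal{S}^\perp\}$. Compatibility: the pair $(W,\mathcal{T})$, with $\mathcal{T}$ a closed subspace, is compatible if there exists $Q\in L(\mathcal{H})$ with $Q^2=Q$, $R(Q)=\mathcal{T}$ and $WQ=Q^*W$. Minus order: for $A,B\in L(\mathcal{H})$, $A \overset{-}{\leq} B$ means that there exist (oblique) projections $P,Q\in L(\mathcal{H})$ (i.e. $P^2=P$, $Q^2=Q$) such that $A=PB$ and $A^*=QB^*$. This is a partial order on $L(\mathcal{H})$. $\mathcal{M}^{-}(W,\mathcal{S})=\{X\in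 L(\mathcal{H}): X\overset{-}{\leq} W,\ R(X)\subseteq\mathcal{S}^\perp,\ R(X^* )\subseteq\mathcal{S}^\perp\}$. *)

theory Defs
  imports "HOL-Analysis.Analysis"
begin

(* Complex inner products are linear in the first argument. *)

class complex_inner = real_normed_vector +
  fixes scaleC :: "complex \<Rightarrow> 'a \<Rightarrow> 'a" (infixr \<open>*\<^sub>C\<close> 75)
    and cinner :: "'a \<Rightarrow> 'a \<Rightarrow> complex"
  assumes scaleC_add_right: "a *\<^sub>C (x + y) = a *\<^sub>C x + a *\<^sub>C y"
    and scaleC_add_left: "(a + b) *\<^sub>C x = a *\<^sub>C x + b *\<^sub>C x"
    and scaleC_scaleC: "a *\<^sub>C (b *\<^sub>C x) = (a * b) *\<^sub>C x"
    and scaleR_scaleC: "scaleR r x = complex_of_real r *\<^sub>C x"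
    and cinner_commute: "cinner x y = cnj (cinner y x)"
    and cinner_add_left: "cinner (x + y) z = cinner x z + cinner y z"
    and cinner_scaleC_left: "cinner (a *\<^sub>C x) y = a * cinner x y"
    and cinner_self: "cinner x x = complex_of_real ((norm x)\<^sup>2)"

class chilbert_space = complex_inner + complete_space

global_interpretation complex_vector:
  vector_space "scaleC :: complex \<Rightarrow> 'a \<Rightarrow> 'a::complex_inner"
  defines csubspace = "complex_vector.subspace"
proof
  show "1 *\<^sub>C x = x" for x :: 'a
    using scaleR_scaleC[of 1 x] by simp
qed (simp_all add: scaleC_add_right scaleC_add_left scaleC_scaleC)

(* Operators are plain functions; the elements of L(H) are those satisfying
   the following predicate. *)
definition bounded_clinear :: "('a::complex_inner \<Rightarrow> 'a) \<Rightarrow> bool" where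
  "bounded_clinear T \<longleftrightarrow>
     Vector_Spaces.linear scaleC scaleC T \<and> (\<exists>K. \<forall>x. norm (T x) \<le> norm x * K)"

definition cadjoint :: "('a::chilbert_space \<Rightarrow> 'a) \<Rightarrow> 'a \<Rightarrow> 'a" where
  "cadjoint T = (THE T'. bounded_clinear T' \<and> (\<forall>x y. cinner (T x) y = cinner x (T' y)))"

definition nullspace :: "('a::complex_inner \<Rightarrow> 'a) \<Rightarrow> 'a set" where
  "nullspace T = {x. T x = 0}"

definition corthogonal :: "'a::complex_inner set \<Rightarrow> 'a set" where
  "corthogonal S = {x. \<forall>s\<in>S. cinner x s = 0}"

definition positive_op :: "('a::complex_inner \<Rightarrow> 'a) \<Rightarrow> bool" where
  "positive_op T \<longleftrightarrow> bounded_clinear T \<and> (\<forall>x. cinner (T x) x \<in> \<real>\<^sub>\<ge>\<^sub>0)"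

definition loewner_le :: "('a::complex_inner \<Rightarrow> 'a) \<Rightarrow> ('a \<Rightarrow> 'a) \<Rightarrow> bool" where
  "loewner_le X Y \<longleftrightarrow> positive_op (\<lambda>x. Y x - X x)"

definition is_maximum :: "('b \<Rightarrow> 'b \<Rightarrow> bool) \<Rightarrow> 'b set \<Rightarrow> 'b \<Rightarrow> bool" where
  "is_maximum le A m \<longleftrightarrow> m \<in> A \<and> (\<forall>x\<in>A. le x m)"

definition shorted :: "('a::complex_inner \<Rightarrow> 'a) \<Rightarrow> 'a set \<Rightarrow> 'a \<Rightarrow> 'a" where
  "shorted W S = (THE Z. is_maximum loewner_le
     {X. bounded_clinear X \<and> loewner_le (\<lambda>_. 0) X \<and> loewner_le X W \<and>
         range X \<subseteq> corthogonal S} Z)"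

definition bounded_projection :: "('a::complex_inner \<Rightarrow> 'a) \<Rightarrow> bool" where
  "bounded_projection P \<longleftrightarrow> bounded_clinear P \<and> P \<circ> P = P"

definition compatible :: "('a::chilbert_space \<Rightarrow> 'a) \<Rightarrow> 'a set \<Rightarrow> bool" where
  "compatible W T \<longleftrightarrow>
     (\<exists>Q. bounded_projection Q \<and> range Q = T \<and> W \<circ> Q = cadjoint Q \<circ> W)"

definition minus_le :: "('a::chilbert_space \<Rightarrow> 'a) \<Rightarrow> ('a \<Rightarrow> 'a) \<Rightarrow> bool" where
  "minus_le A B \<longleftrightarrow>
     (\<exists>P Q. bounded_projection P \<and> bounded_projection Q \<and>
        A = P \<circ> B \<and> cadjoint A = Q \<circ> cadjoint B)"

definition minus_set :: "('a::chilbert_space \<Rightarrow> 'a) \<Rightarrow> 'a set \<Rightarrow> ('a \<Rightarrow> 'a) set" where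
  "minus_set W S = {X. bounded_clinear X \<and> minus_le X W \<and>
     range X \<subseteq> corthogonal S \<and> range (cadjoint X) \<subseteq> corthogonal S}"

end

theory Submission
  imports Defs
begin

text \<open>Let \<open>Z\<close> be \<open>W\<close> shorted to \<open>S\<close>. The key observation is that \<open>Z x\<close> is the limit of \<open>W (u n)\<close> for a
sequence in the affine space \<open>x + S\<close> (lemma \<open>shorted_limit\<close>), namely one that minimizes the quadratic
form of \<open>W\<close> there. Such a sequence is Cauchy in the seminorm of \<open>W\<close>, and the limits of
the images define an operator whose quadratic form at \<open>x\<close> is the infimum of that of \<open>W\<close> over \<open>x + S\<close>;
this is the largest form below \<open>W\<close> that does not see \<open>S\<close>.

If \<open>X\<close> lies in \<open>minus_set W S\<close>, then \<open>X = P W\<close> with a projection \<open>P\<close>, and \<open>X\<close> vanishes on \<open>S\<close>. Hence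
\<open>X x = X (u n) = P (W (u n))\<close>, and in the limit \<open>X = P Z\<close>. The same holds for the adjoint of \<open>X\<close>, so \<open>X\<close> is
always below \<open>Z\<close> in the minus order. Thus \<open>Z\<close> is the maximum if and only if \<open>Z\<close> is below \<open>W\<close> in the
minus order (lemma \<open>shorted_maximum_minus_set_iff\<close>), which for positive operators means that
\<open>Z = W E = E\<^sup>* W\<close> for a single projection \<open>E\<close> (lemma \<open>minus_le_positive_iff\<close>).

It remains to compare this with compatibility. If \<open>Q\<close> is a projection onto the nullspace of \<open>Z\<close> with \<open>W Q\<close>
self-adjoint, then \<open>Z = W (I - Q)\<close> by the maximality of \<open>Z\<close>, and \<open>E = I - Q\<close> works (lemma
\<open>shorted_if_compatible\<close>). Conversely, given \<open>E\<close>, the projection \<open>I - E\<close> has \<open>W (I - E)\<close> self-adjoint, and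
it becomes a projection onto all of the nullspace of \<open>Z = W E\<close> after adding a part on which \<open>W\<close> vanishes
(lemma \<open>compatible_nullspace_if_symmetric_projection\<close>).

Orthogonal projections onto closed subspaces, and from them adjoints, come from the same minimization
argument with the identity in place of \<open>W\<close>.\<close>

section \<open>Inner products and bounded operators\<close>

lemma cinner_add_right: "cinner x (y + z) = cinner x y + cinner x z"
  by (metis cinner_add_left cinner_commute complex_cnj_add)

lemma cinner_scaleC_right: "cinner x (a *\<^sub>C y) = cnj a * cinner x y"
  by (metis cinner_scaleC_left cinner_commute complex_cnj_mult)

lemma cinner_zero_left [simp]: "cinner 0 y = 0"
  using cinner_add_left[of 0 0 y] by simp

lemma cinner_zero_right [simp]: "cinner x 0 = 0"
  using cinner_add_right[of x 0 0] by simp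

lemma cinner_diff_left: "cinner (x - y) z = cinner x z - cinner y z"
  using cinner_add_left[of "x - y" y z] by simp

lemma cinner_diff_right: "cinner x (y - z) = cinner x y - cinner x z"
  using cinner_add_right[of x "y - z" z] by simp

lemma cinner_eq_zero_iff: "cinner x x = 0 \<longleftrightarrow> x = 0"
  by (simp add: cinner_self)

lemma cinner_ext: "(\<And>z. cinner x z = cinner y z) \<Longrightarrow> x = y"
  using cinner_eq_zero_iff[of "x - y"] by (simp add: cinner_diff_left)

lemma cinner_ext_right: "(\<And>z. cinner z x = cinner z y) \<Longrightarrow> x = y"
  using cinner_eq_zero_iff[of "x - y"] by (simp add: cinner_diff_right)

lemma bounded_clinear_iff:
  "bounded_clinear T \<longleftrightarrow> (\<forall>x y. T (x + y) = T x + T y) \<and> (\<forall>a x. T (a *\<^sub>C x) = a *\<^sub>C T x) \<and>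
     (\<exists>K. \<forall>x. norm (T x) \<le> norm x * K)"
  unfolding bounded_clinear_def
    Vector_Spaces.linear_iff
  using complex_vector.vector_space_axioms by auto

lemma bounded_clinearD:
  assumes "bounded_clinear T"
  shows "T (x + y) = T x + T y" "T (a *\<^sub>C x) = a *\<^sub>C T x" "bounded_linear T"
proof -
  from assms have add: "T (x + y) = T x + T y" and scale: "T (a *\<^sub>C x) = a *\<^sub>C T x" for x y a
    unfolding bounded_clinear_iff by blast+
  from assms obtain K where K: "norm (T x) \<le> norm x * K" for x
    unfolding bounded_clinear_iff by blast
  show "bounded_linear T"
    by (rule bounded_linear_intro[OF add _ K]) (simp add: scaleR_scaleC scale)
  show "T (x + y) = T x + T y" "T (a *\<^sub>C x) = a *\<^sub>C T x"
    by (rule add scale)+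
qed

lemma bounded_clinear_zero_diff:
  assumes "bounded_clinear T"
  shows "T 0 = 0" "T (x - y) = T x - T y"
  using bounded_clinearD(3)[OF assms]
  by (auto simp: linear_simps)

lemma bounded_clinearI:
  assumes "\<And>x y. T (x + y) = T x + T y" "\<And>a x. T (a *\<^sub>C x) = a *\<^sub>C T x"
    "bounded_linear T"
  shows "bounded_clinear T"
  using assms bounded_linear.bounded by (auto simp: bounded_clinear_iff)

lemma bounded_clinear_id: "bounded_clinear (\<lambda>x. x)"
  by (rule bounded_clinearI) auto

lemma bounded_clinear_zero: "bounded_clinear (\<lambda>x. 0)"
  by (rule bounded_clinearI) auto

lemma bounded_clinear_compose:
  assumes "bounded_clinear T" "bounded_clinear U"
  shows "bounded_clinear (\<lambda>x. T (U x))"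
  by (rule bounded_clinearI)
    (use assms in \<open>auto simp: bounded_clinearD intro: bounded_linear_compose\<close>)

lemma bounded_clinear_add:
  assumes "bounded_clinear T" "bounded_clinear U"
  shows "bounded_clinear (\<lambda>x. T x + U x)"
  by (rule bounded_clinearI)
    (use assms in \<open>auto simp: bounded_clinearD scaleC_add_right intro: bounded_linear_add\<close>)

lemma bounded_clinear_diff:
  assumes "bounded_clinear T" "bounded_clinear U"
  shows "bounded_clinear (\<lambda>x. T x - U x)"
  by (rule bounded_clinearI)
    (use assms in \<open>auto simp: bounded_clinearD complex_vector.scale_right_diff_distrib intro: bounded_linear_sub\<close>)

section \<open>The form of a positive operator\<close>

lemma positive_op_id: "positive_op (\<lambda>x. x)"
  by (simp add: positive_op_def bounded_clinear_id cinner_self nonneg_Reals_of_real_iff)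

lemma positive_op_bounded: "positive_op W \<Longrightarrow> bounded_clinear W"
  by (simp add: positive_op_def)

text \<open>Polarization: the form is real on the diagonal, and evaluating it at \<open>x + y\<close> and at
\<open>x + \<i>y\<close> determines the imaginary and the real part of the defect of symmetry.\<close>

lemma positive_op_hermitian:
  assumes "positive_op W"
  shows "cinner (W x) y = cinner x (W y)"
proof -
  note lin = bounded_clinearD[OF positive_op_bounded[OF assms]]
  have real: "Im (cinner (W z) z) = 0" for z
    using assms by (auto simp: positive_op_def complex_nonneg_Reals_iff)
  have "Im (cinner (W x) y) + Im (cinner (W y) x) = 0"
    using real[of "x + y"] real[of x] real[of y]
    by (simp add: lin cinner_add_left cinner_add_right)
  moreover have "Re (cinner (W y) x) - Re (cinner (W x) y) = 0"
    using real[of "x + \<i> *\<^sub>C y"] real[of x] real[of y]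
    by (simp add: lin cinner_add_left cinner_add_right cinner_scaleC_left cinner_scaleC_right)
  ultimately have "cinner (W x) y = cnj (cinner (W y) x)"
    by (simp add: complex_eq_iff)
  then show ?thesis
    by (metis cinner_commute)
qed

text \<open>This is the seminorm \<open>\<parallel>W\<^sup>1\<^sup>/\<^sup>2 x\<parallel>\<close>. All arguments below that are usually made with the square root
of \<open>W\<close> are expressed by this seminorm and its dual.\<close>

definition form_norm :: "('a::complex_inner \<Rightarrow> 'a) \<Rightarrow> 'a \<Rightarrow> real" where
  "form_norm W x = sqrt (Re (cinner (W x) x))"

lemma form_norm_nonneg:
  assumes "positive_op W" shows "0 \<le> form_norm W x"
  using assms by (simp add: form_norm_def positive_op_def complex_nonneg_Reals_iff)

lemma cinner_form:
  assumes "positive_op W"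
  shows "cinner (W x) x = complex_of_real ((form_norm W x)\<^sup>2)"
  using assms by (simp add: form_norm_def positive_op_def complex_nonneg_Reals_iff complex_eq_iff)

lemma form_norm_id: "form_norm (\<lambda>x. x) x = norm x"
  by (simp add: form_norm_def cinner_self)

lemma form_norm_add_square:
  assumes "positive_op W"
  shows "(form_norm W (x + y))\<^sup>2 = (form_norm W x)\<^sup>2 + 2 * Re (cinner (W x) y) + (form_norm W y)\<^sup>2"
proof -
  note lin = bounded_clinearD[OF positive_op_bounded[OF assms]]
  have "Re (cinner (W y) x) = Re (cinner (W x) y)"
    using positive_op_hermitian[OF assms, of y x] cinner_commute[of y "W x"] by simp
  moreover have "(form_norm W z)\<^sup>2 = Re (cinner (W z) z)" for z
    by (simp add: cinner_form[OF assms])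
  ultimately show ?thesis
    by (simp add: lin cinner_add_left cinner_add_right)
qed

lemma form_norm_scaleC:
  assumes "positive_op W"
  shows "form_norm W (a *\<^sub>C x) = cmod a * form_norm W x"
proof -
  note lin = bounded_clinearD[OF positive_op_bounded[OF assms]]
  have "cinner (W (a *\<^sub>C x)) (a *\<^sub>C x) = complex_of_real ((cmod a)\<^sup>2) * cinner (W x) x"
    using complex_norm_square[of a]
    by (simp add: lin cinner_scaleC_left cinner_scaleC_right mult_ac)
  then show ?thesis
    by (simp add: form_norm_def real_sqrt_mult)
qed

text \<open>If moving from \<open>u\<close> along the complex line spanned by \<open>d\<close> cannot decrease the squared seminorm by
more than \<open>e\<close>, then \<open>u\<close> is almost orthogonal to \<open>d\<close>. With \<open>e = \<parallel>u\<parallel>\<^sup>2\<close> the hypothesis holds for every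
\<open>d\<close> and the conclusion is the Cauchy--Schwarz inequality; with a near minimizer \<open>u\<close> it becomes the
variational characterization of the projection.\<close>

lemma form_almost_orthogonal:
  assumes W: "positive_op W"
    and near: "\<And>t. (form_norm W u)\<^sup>2 \<le> (form_norm W (u + t *\<^sub>C d))\<^sup>2 + e"
  shows "(cmod (cinner (W u) d))\<^sup>2 \<le> e * (form_norm W d)\<^sup>2"
proof -
  define c where "c = cinner (W u) d"
  define A where "A = (cmod c)\<^sup>2"
  define D where "D = (form_norm W d)\<^sup>2"
  have quad: "0 \<le> e - 2 * r * A + r\<^sup>2 * A * D" for r
  proof -
    \<comment> \<open>the phase that makes the cross term real, with the sign of \<open>- r\<close>\<close>
    define t where "t = - complex_of_real r * c"
    have "cinner (W u) (t *\<^sub>C d) = - complex_of_real (r * A)"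
      using complex_norm_square[of c]
      by (simp add: t_def A_def cinner_scaleC_right c_def[symmetric] mult_ac del: complex_vector.scale_minus_left)
    moreover have "(form_norm W (t *\<^sub>C d))\<^sup>2 = r\<^sup>2 * A * D"
      by (simp add: t_def form_norm_scaleC[OF W] norm_mult A_def D_def power_mult_distrib
          del: complex_vector.scale_minus_left)
    ultimately show ?thesis
      using near[of t] by (simp add: form_norm_add_square[OF W])
  qed
  have "A \<ge> 0" "D \<ge> 0"
    by (auto simp: A_def D_def)
  have "A \<le> e * D"
  proof (cases "D = 0")
    case True
    \<comment> \<open>the quadratic in \<open>r\<close> degenerates to a line, which takes the value \<open>-1\<close> at this point unless \<open>A = 0\<close>\<close>
    then show ?thesis
      using quad[of "(e + 1) / (2 * A)"] \<open>A \<ge> 0\<close> by (cases "A = 0") auto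
  next
    case False
    \<comment> \<open>the minimum of the quadratic\<close>
    then show ?thesis
      using quad[of "1 / D"] \<open>D \<ge> 0\<close> by (simp add: field_simps power2_eq_square)
  qed
  then show ?thesis
    by (simp add: A_def D_def c_def)
qed

lemma form_Cauchy_Schwarz:
  assumes W: "positive_op W"
  shows "cmod (cinner (W x) y) \<le> form_norm W x * form_norm W y"
proof -
  have "(cmod (cinner (W x) y))\<^sup>2 \<le> (form_norm W x)\<^sup>2 * (form_norm W y)\<^sup>2"
    by (rule form_almost_orthogonal[OF W]) simp
  then have "(cmod (cinner (W x) y))\<^sup>2 \<le> (form_norm W x * form_norm W y)\<^sup>2"
    by (simp add: power_mult_distrib)
  then show ?thesis
    by (rule power2_le_imp_le) (simp add: form_norm_nonneg[OF W])
qed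

lemma cinner_Cauchy_Schwarz: "cmod (cinner x y) \<le> norm x * norm y"
  using form_Cauchy_Schwarz[OF positive_op_id, of x y] by (simp add: form_norm_id)

lemma form_norm_bounded:
  assumes W: "positive_op W"
  obtains K where "K > 0" "\<And>x. form_norm W x \<le> K * norm x"
proof -
  obtain L where L: "L > 0" "norm (W x) \<le> norm x * L" for x
    using bounded_linear.pos_bounded[OF bounded_clinearD(3)[OF positive_op_bounded[OF W]]] by blast
  have "form_norm W x \<le> sqrt L * norm x" for x
  proof -
    have "Re (cinner (W x) x) \<le> norm (W x) * norm x"
      by (rule order_trans[OF complex_Re_le_cmod cinner_Cauchy_Schwarz])
    also have "\<dots> \<le> L * (norm x)\<^sup>2"
      using mult_right_mono[OF L(2)[of x], of "norm x"] by (simp add: power2_eq_square mult_ac)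
    finally have "form_norm W x \<le> sqrt (L * (norm x)\<^sup>2)"
      by (simp add: form_norm_def)
    then show ?thesis
      by (simp add: real_sqrt_mult)
  qed
  with L(1) show ?thesis
    by (intro that[of "sqrt L"]) simp_all
qed

text \<open>The dual of the seminorm of \<open>W\<close> is stronger than the norm, so limits in the dual seminorm are norm
limits. This replaces the continuity of \<open>W\<^sup>1\<^sup>/\<^sup>2\<close>.\<close>

lemma form_dual_bound_norm:
  assumes W: "positive_op W"
  obtains K where "K > 0"
    "\<And>y e. (\<And>z. cmod (cinner y z) \<le> e * form_norm W z) \<Longrightarrow> 0 \<le> e \<Longrightarrow> norm y \<le> e * K"
proof -
  obtain K where K: "K > 0" "\<And>x. form_norm W x \<le> K * norm x"
    using form_norm_bounded[OF W] by blast
  have "norm y \<le> e * K" if y: "\<And>z. cmod (cinner y z) \<le> e * form_norm W z" and "0 \<le> e" for y e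
  proof (cases "y = 0")
    case False
    have "norm y * norm y = cmod (cinner y y)"
      by (simp add: cinner_self power2_eq_square norm_mult)
    also have "\<dots> \<le> e * form_norm W y"
      by (rule y)
    also have "\<dots> \<le> e * K * norm y"
      using mult_left_mono[OF K(2)[of y] \<open>0 \<le> e\<close>] by (simp add: mult_ac)
    finally show ?thesis
      using False by simp
  qed (use K(1) \<open>0 \<le> e\<close> in simp)
  with K(1) show ?thesis
    by (rule that)
qed

lemma bounded_linear_cinner_left: "bounded_linear (\<lambda>x. cinner x y)"
  by (rule bounded_linear_intro[of _ "norm y"])
    (auto simp: cinner_add_left scaleR_scaleC cinner_scaleC_left scaleR_conv_of_real cinner_Cauchy_Schwarz)

lemmas tendsto_cinner_left = bounded_linear.tendsto[OF bounded_linear_cinner_left]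

section \<open>The shorted operator as a limit of minimizers\<close>

text \<open>The relation describes \<open>y = W\<^sup>1\<^sup>/\<^sup>2 P W\<^sup>1\<^sup>/\<^sup>2 x\<close>, where \<open>P\<close> is the orthogonal projection onto the
complement of \<open>W\<^sup>1\<^sup>/\<^sup>2 S\<close>. The bound in the second conjunct says that \<open>y = W\<^sup>1\<^sup>/\<^sup>2 h\<close> for some \<open>h\<close> at distance at
most \<open>e\<close> from \<open>W\<^sup>1\<^sup>/\<^sup>2 u\<close>, so that \<open>h\<close> lies in the closure of \<open>W\<^sup>1\<^sup>/\<^sup>2 (x + S)\<close>; the first conjunct says that
\<open>h\<close> is orthogonal to \<open>W\<^sup>1\<^sup>/\<^sup>2 S\<close>. An infimum over \<open>x + S\<close> need not be attained, which is why \<open>u\<close> depends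
on \<open>e\<close>.\<close>

definition projects_to :: "('a::complex_inner \<Rightarrow> 'a) \<Rightarrow> 'a set \<Rightarrow> 'a \<Rightarrow> 'a \<Rightarrow> bool" where
  "projects_to W S x y \<longleftrightarrow> y \<in> corthogonal S \<and>
     (\<forall>e>0. \<exists>u. u - x \<in> S \<and> (\<forall>z. cmod (cinner (W u - y) z) \<le> e * form_norm W z))"

text \<open>Take \<open>u\<close> whose squared seminorm exceeds the infimum over \<open>x + S\<close> by less than \<open>e\<^sup>2\<close>.\<close>

lemma near_minimizer:
  assumes W: "positive_op W" and S: "csubspace S" and "e > 0"
  obtains u where "u - x \<in> S" "\<And>d. d \<in> S \<Longrightarrow> cmod (cinner (W u) d) \<le> e * form_norm W d"
proof -
  define Q where "Q = (\<lambda>s. (form_norm W (x + s))\<^sup>2) ` S"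
  have "Q \<noteq> {}"
    using complex_vector.subspace_0[OF S] by (auto simp: Q_def)
  have bdd: "bdd_below Q"
    by (auto simp: Q_def intro!: bdd_belowI[of _ 0])
  have "Inf Q < Inf Q + e\<^sup>2"
    using \<open>e > 0\<close> by simp
  then have "\<exists>q\<in>Q. q < Inf Q + e\<^sup>2"
    using cInf_less_iff[OF \<open>Q \<noteq> {}\<close> bdd] by blast
  then obtain s where s: "s \<in> S" "(form_norm W (x + s))\<^sup>2 < Inf Q + e\<^sup>2"
    by (auto simp: Q_def)
  show ?thesis
  proof (rule that)
    show "(x + s) - x \<in> S"
      using s by simp
    fix d assume d: "d \<in> S"
    have "(form_norm W (x + s))\<^sup>2 \<le> (form_norm W ((x + s) + t *\<^sub>C d))\<^sup>2 + e\<^sup>2" for t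
    proof -
      have "s + t *\<^sub>C d \<in> S"
        using complex_vector.subspace_add[OF S s(1)] complex_vector.subspace_scale[OF S d] by blast
      then have "(form_norm W (x + (s + t *\<^sub>C d)))\<^sup>2 \<in> Q"
        unfolding Q_def by (rule imageI)
      then have "Inf Q \<le> (form_norm W ((x + s) + t *\<^sub>C d))\<^sup>2"
        using cInf_lower[OF _ bdd] by (simp add: add.assoc)
      with s(2) show ?thesis
        by simp
    qed
    then have "(cmod (cinner (W (x + s)) d))\<^sup>2 \<le> e\<^sup>2 * (form_norm W d)\<^sup>2"
      by (rule form_almost_orthogonal[OF W])
    then have "(cmod (cinner (W (x + s)) d))\<^sup>2 \<le> (e * form_norm W d)\<^sup>2"
      by (simp add: power_mult_distrib)
    then show "cmod (cinner (W (x + s)) d) \<le> e * form_norm W d"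
      by (rule power2_le_imp_le) (use \<open>e > 0\<close> form_norm_nonneg[OF W] in simp)
  qed
qed

text \<open>Near minimizers are almost orthogonal to \<open>S\<close>, hence to their own differences, which lie in \<open>S\<close>.
So a minimizing sequence is Cauchy in the seminorm and its image under \<open>W\<close> is Cauchy in the dual
seminorm, which gives a norm limit.\<close>

lemma projects_to_exists:
  fixes W :: "'a::chilbert_space \<Rightarrow> 'a"
  assumes W: "positive_op W" and S: "csubspace S"
  shows "\<exists>y. projects_to W S x y"
proof -
  note Wb = positive_op_bounded[OF W]
  define e where "e n = inverse (real (Suc n))" for n
  have epos: "e n > 0" for n
    by (simp add: e_def)
  have elim: "e \<longlonglongrightarrow> 0"
    unfolding e_def by (rule LIMSEQ_inverse_real_of_nat)
  have "\<exists>u. u - x \<in> S \<and> (\<forall>d\<in>S. cmod (cinner (W u) d) \<le> e n * form_norm W d)" for n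
    using near_minimizer[OF W S epos, of x] by metis
  then obtain u where uS: "\<And>n. u n - x \<in> S"
    and orth: "\<And>n d. d \<in> S \<Longrightarrow> cmod (cinner (W (u n)) d) \<le> e n * form_norm W d"
    by metis
  have close: "form_norm W (u n - u m) \<le> e n + e m" for n m
  proof -
    define d where "d = u n - u m"
    have d: "d \<in> S"
      using complex_vector.subspace_diff[OF S uS[of n] uS[of m]] by (simp add: d_def)
    have "(form_norm W d)\<^sup>2 = cmod (cinner (W d) d)"
      by (simp add: cinner_form[OF W] norm_power form_norm_nonneg[OF W])
    also have "\<dots> = cmod (cinner (W (u n)) d - cinner (W (u m)) d)"
      by (simp add: d_def bounded_clinear_zero_diff[OF Wb] cinner_diff_left)
    also have "\<dots> \<le> cmod (cinner (W (u n)) d) + cmod (cinner (W (u m)) d)"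
      by (rule norm_triangle_ineq4)
    also have "\<dots> \<le> (e n + e m) * form_norm W d"
      using orth[OF d, of n] orth[OF d, of m] by (simp add: distrib_right)
    finally have "form_norm W d * form_norm W d \<le> (e n + e m) * form_norm W d"
      by (simp add: power2_eq_square)
    then show ?thesis
      using form_norm_nonneg[OF W, of d] epos[of n] epos[of m]
      by (cases "form_norm W d = 0") (auto simp: d_def)
  qed
  have dual: "cmod (cinner (W (u n) - W (u m)) z) \<le> (e n + e m) * form_norm W z" for n m z
  proof -
    have "cmod (cinner (W (u n) - W (u m)) z) \<le> form_norm W (u n - u m) * form_norm W z"
      using form_Cauchy_Schwarz[OF W] by (simp flip: bounded_clinear_zero_diff[OF Wb])
    also have "\<dots> \<le> (e n + e m) * form_norm W z"
      by (rule mult_right_mono[OF close form_norm_nonneg[OF W]])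
    finally show ?thesis .
  qed
  obtain K where K: "K > 0"
    "\<And>y r. (\<And>z. cmod (cinner y z) \<le> r * form_norm W z) \<Longrightarrow> 0 \<le> r \<Longrightarrow> norm y \<le> r * K"
    using form_dual_bound_norm[OF W] by blast
  have "Cauchy (\<lambda>n. W (u n))"
  proof (rule metric_CauchyI)
    fix r :: real assume "r > 0"
    then have "r / (2 * K) > 0"
      using K(1) by simp
    then have "eventually (\<lambda>n. e n < r / (2 * K)) sequentially"
      using order_tendstoD(2)[OF elim] by blast
    then obtain M where M: "e n < r / (2 * K)" if "n \<ge> M" for n
      unfolding eventually_sequentially by blast
    have "dist (W (u m)) (W (u n)) < r" if "m \<ge> M" "n \<ge> M" for m n
    proof -
      have "norm (W (u m) - W (u n)) \<le> (e m + e n) * K"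
        using dual epos[of m] epos[of n] by (intro K(2)) auto
      also have "\<dots> < (r / (2 * K) + r / (2 * K)) * K"
        by (rule mult_strict_right_mono[OF add_strict_mono[OF M M] K(1)]) (use that in auto)
      also have "\<dots> = r"
        using K(1) by simp
      finally show ?thesis
        by (simp add: dist_norm)
    qed
    then show "\<exists>M. \<forall>m\<ge>M. \<forall>n\<ge>M. dist (W (u m)) (W (u n)) < r"
      by blast
  qed
  then obtain y where y: "(\<lambda>n. W (u n)) \<longlonglongrightarrow> y"
    using Cauchy_convergent convergent_def by blast
  have "cinner y d = 0" if "d \<in> S" for d
  proof -
    have "(\<lambda>n. cmod (cinner (W (u n)) d)) \<longlonglongrightarrow> cmod (cinner y d)"
      by (intro tendsto_norm tendsto_cinner_left y)
    moreover have "(\<lambda>n. e n * form_norm W d) \<longlonglongrightarrow> 0 * form_norm W d"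
      by (intro tendsto_mult elim tendsto_const)
    ultimately have "cmod (cinner y d) \<le> 0 * form_norm W d"
      by (rule LIMSEQ_le) (use orth[OF that] in auto)
    then show ?thesis
      by simp
  qed
  moreover have lim_dual: "cmod (cinner (W (u n) - y) z) \<le> e n * form_norm W z" for n z
  proof -
    have "(\<lambda>m. cmod (cinner (W (u n) - W (u m)) z)) \<longlonglongrightarrow> cmod (cinner (W (u n) - y) z)"
      by (intro tendsto_norm tendsto_cinner_left tendsto_diff tendsto_const y)
    moreover have "(\<lambda>m. (e n + e m) * form_norm W z) \<longlonglongrightarrow> (e n + 0) * form_norm W z"
      by (intro tendsto_mult tendsto_add elim tendsto_const)
    ultimately have "cmod (cinner (W (u n) - y) z) \<le> (e n + 0) * form_norm W z"
      by (rule LIMSEQ_le) (use dual in auto)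
    then show ?thesis
      by simp
  qed
  have "\<exists>v. v - x \<in> S \<and> (\<forall>z. cmod (cinner (W v - y) z) \<le> r * form_norm W z)" if "r > 0" for r
  proof -
    have "eventually (\<lambda>n. e n < r) sequentially"
      using order_tendstoD(2)[OF elim that] .
    then obtain n where "e n < r"
      by (auto simp: eventually_sequentially)
    then have "cmod (cinner (W (u n) - y) z) \<le> r * form_norm W z" for z
      using lim_dual[of n z] mult_right_mono[of "e n" r "form_norm W z"] form_norm_nonneg[OF W, of z]
      by linarith
    with uS show ?thesis
      by blast
  qed
  with calculation show ?thesis
    by (auto simp: projects_to_def corthogonal_def)
qed

text \<open>Two approximants \<open>u\<close> and \<open>v\<close> differ by some \<open>d \<in> S\<close> for which \<open>W d\<close> is close to \<open>y - y\<^sub>1\<close>, where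
\<open>y\<^sub>1\<close> is the other value. As \<open>y - y\<^sub>1\<close> annihilates \<open>d\<close>, testing this approximation with \<open>d\<close> itself
shows that \<open>d\<close> is small, and then so is \<open>y - y\<^sub>1\<close>.\<close>

lemma projects_to_unique:
  assumes W: "positive_op W" and S: "csubspace S"
    and y: "projects_to W S x y" and y': "projects_to W S x y'"
  shows "y = y'"
proof (rule cinner_ext)
  note Wb = positive_op_bounded[OF W]
  fix z
  have bound: "cmod (cinner (y - y') z) \<le> e * (4 * form_norm W z)" if "e > 0" for e
  proof -
    obtain u where u: "u - x \<in> S" "\<And>z. cmod (cinner (W u - y) z) \<le> e * form_norm W z"
      using y \<open>e > 0\<close> unfolding projects_to_def by blast
    obtain v where v: "v - x \<in> S" "\<And>z. cmod (cinner (W v - y') z) \<le> e * form_norm W z"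
      using y' \<open>e > 0\<close> unfolding projects_to_def by blast
    define d where "d = u - v"
    have d: "d \<in> S"
      using complex_vector.subspace_diff[OF S u(1) v(1)] by (simp add: d_def)
    have diff: "cmod (cinner (W d - (y - y')) z) \<le> 2 * e * form_norm W z" for z
    proof -
      have "cmod (cinner (W d - (y - y')) z) = cmod (cinner (W u - y) z - cinner (W v - y') z)"
        by (simp add: d_def bounded_clinear_zero_diff[OF Wb] cinner_diff_left cinner_add_left
            algebra_simps)
      also have "\<dots> \<le> cmod (cinner (W u - y) z) + cmod (cinner (W v - y') z)"
        by (rule norm_triangle_ineq4)
      finally show ?thesis
        using u(2)[of z] v(2)[of z] by simp
    qed
    have "cinner (y - y') d = 0"
      using y y' d by (simp add: projects_to_def corthogonal_def cinner_diff_left)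
    then have "form_norm W d * form_norm W d \<le> 2 * e * form_norm W d"
      using diff[of d] by (simp add: cinner_diff_left cinner_form[OF W] norm_power power2_eq_square norm_mult)
    then have d_small: "form_norm W d \<le> 2 * e"
      using form_norm_nonneg[OF W, of d] \<open>e > 0\<close> by (cases "form_norm W d = 0") auto
    have "cmod (cinner (y - y') z) = cmod (cinner (W d) z - cinner (W d - (y - y')) z)"
      by (simp add: cinner_diff_left)
    also have "\<dots> \<le> cmod (cinner (W d) z) + cmod (cinner (W d - (y - y')) z)"
      by (rule norm_triangle_ineq4)
    also have "\<dots> \<le> form_norm W d * form_norm W z + 2 * e * form_norm W z"
      using form_Cauchy_Schwarz[OF W] diff by (rule add_mono)
    also have "\<dots> \<le> 2 * e * form_norm W z + 2 * e * form_norm W z"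
      using mult_right_mono[OF d_small form_norm_nonneg[OF W, of z]] by simp
    finally show ?thesis
      by simp
  qed
  have "cmod (cinner (y - y') z) \<le> 0"
  proof (rule field_le_epsilon)
    fix r :: real assume "r > 0"
    have pos: "4 * form_norm W z + 1 > 0"
      using form_norm_nonneg[OF W, of z] by simp
    have "cmod (cinner (y - y') z) \<le> r / (4 * form_norm W z + 1) * (4 * form_norm W z)"
      by (rule bound[OF divide_pos_pos[OF \<open>r > 0\<close> pos]])
    also have "\<dots> \<le> r"
      using \<open>r > 0\<close> pos by (simp add: field_simps)
    finally show "cmod (cinner (y - y') z) \<le> 0 + r"
      by simp
  qed
  then show "cinner y z = cinner y' z"
    by (simp add: cinner_diff_left)
qed

lemma projects_to_add:
  assumes W: "positive_op W" and S: "csubspace S"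
    and y: "projects_to W S x y" and y': "projects_to W S x' y'"
  shows "projects_to W S (x + x') (y + y')"
proof -
  have "\<exists>w. w - (x + x') \<in> S \<and> (\<forall>z. cmod (cinner (W w - (y + y')) z) \<le> e * form_norm W z)"
    if "e > 0" for e
  proof -
    from that have half: "e / 2 > 0"
      by simp
    obtain u where u: "u - x \<in> S" "\<And>z. cmod (cinner (W u - y) z) \<le> e / 2 * form_norm W z"
      using y half unfolding projects_to_def by blast
    obtain v where v: "v - x' \<in> S" "\<And>z. cmod (cinner (W v - y') z) \<le> e / 2 * form_norm W z"
      using y' half unfolding projects_to_def by blast
    have "(u + v) - (x + x') \<in> S"
      using complex_vector.subspace_add[OF S u(1) v(1)] by (simp add: algebra_simps)
    moreover have "cmod (cinner (W (u + v) - (y + y')) z) \<le> e * form_norm W z" for z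
    proof -
      have "cmod (cinner (W (u + v) - (y + y')) z) = cmod (cinner (W u - y) z + cinner (W v - y') z)"
        by (simp add: bounded_clinearD[OF positive_op_bounded[OF W]] cinner_add_left cinner_diff_left
            add_diff_add)
      also have "\<dots> \<le> cmod (cinner (W u - y) z) + cmod (cinner (W v - y') z)"
        by (rule norm_triangle_ineq)
      finally show ?thesis
        using u(2)[of z] v(2)[of z] by simp
    qed
    ultimately show ?thesis
      by blast
  qed
  then show ?thesis
    using y y' by (auto simp: projects_to_def corthogonal_def cinner_add_left)
qed

lemma projects_to_scaleC:
  assumes W: "positive_op W" and S: "csubspace S" and y: "projects_to W S x y"
  shows "projects_to W S (a *\<^sub>C x) (a *\<^sub>C y)"
proof -
  have "\<exists>w. w - a *\<^sub>C x \<in> S \<and> (\<forall>z. cmod (cinner (W w - a *\<^sub>C y) z) \<le> e * form_norm W z)"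
    if "e > 0" for e
  proof -
    have pos: "cmod a + 1 > 0"
      using norm_ge_zero[of a] by linarith
    with that have "e / (cmod a + 1) > 0"
      by simp
    then obtain u where u: "u - x \<in> S"
      "\<And>z. cmod (cinner (W u - y) z) \<le> e / (cmod a + 1) * form_norm W z"
      using y unfolding projects_to_def by blast
    have "a *\<^sub>C u - a *\<^sub>C x \<in> S"
      using complex_vector.subspace_scale[OF S u(1)] by (simp add: complex_vector.scale_right_diff_distrib)
    moreover have "cmod (cinner (W (a *\<^sub>C u) - a *\<^sub>C y) z) \<le> e * form_norm W z" for z
    proof -
      have "cmod (cinner (W (a *\<^sub>C u) - a *\<^sub>C y) z) = cmod a * cmod (cinner (W u - y) z)"
        by (simp add: bounded_clinearD[OF positive_op_bounded[OF W]] cinner_scaleC_left norm_mult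
            flip: complex_vector.scale_right_diff_distrib)
      also have "\<dots> \<le> cmod a * (e / (cmod a + 1) * form_norm W z)"
        by (rule mult_left_mono[OF u(2)]) simp
      also have "\<dots> = (cmod a * (e / (cmod a + 1))) * form_norm W z"
        by simp
      also have "\<dots> \<le> e * form_norm W z"
        by (rule mult_right_mono[OF _ form_norm_nonneg[OF W]]) (use that pos in \<open>simp add: field_simps\<close>)
      finally show ?thesis .
    qed
    ultimately show ?thesis
      by blast
  qed
  then show ?thesis
    using y by (auto simp: projects_to_def corthogonal_def cinner_scaleC_left)
qed

text \<open>The bound on the seminorm of \<open>u n\<close> is an approximate Pythagorean theorem: \<open>x = u n + d\<close> with
\<open>d \<in> S\<close> almost orthogonal to \<open>u n\<close>.\<close>

lemma projects_to_sequence: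
  assumes W: "positive_op W" and S: "csubspace S" and y: "projects_to W S x y"
  obtains u where "\<And>n. u n - x \<in> S" "(\<lambda>n. W (u n)) \<longlonglongrightarrow> y"
    "\<And>n. form_norm W (u n) \<le> form_norm W x + inverse (real (Suc n))"
    "\<And>n z. cmod (cinner (W (u n) - y) z) \<le> inverse (real (Suc n)) * form_norm W z"
proof -
  define e where "e n = inverse (real (Suc n))" for n
  have epos: "e n > 0" for n
    by (simp add: e_def)
  have elim: "e \<longlonglongrightarrow> 0"
    unfolding e_def by (rule LIMSEQ_inverse_real_of_nat)
  have "\<exists>u. u - x \<in> S \<and> (\<forall>z. cmod (cinner (W u - y) z) \<le> e n * form_norm W z)" for n
    using y epos unfolding projects_to_def by blast
  then obtain u where uS: "\<And>n. u n - x \<in> S"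
    and dual: "\<And>n z. cmod (cinner (W (u n) - y) z) \<le> e n * form_norm W z"
    by metis
  obtain K where K: "K > 0"
    "\<And>y r. (\<And>z. cmod (cinner y z) \<le> r * form_norm W z) \<Longrightarrow> 0 \<le> r \<Longrightarrow> norm y \<le> r * K"
    using form_dual_bound_norm[OF W] by blast
  have "norm (W (u n) - y) \<le> e n * K" for n
    using dual epos[of n] by (intro K(2)) auto
  moreover have "(\<lambda>n. e n * K) \<longlonglongrightarrow> 0"
    using tendsto_mult[OF elim tendsto_const[of K]] by simp
  ultimately have "(\<lambda>n. W (u n) - y) \<longlonglongrightarrow> 0"
    by (rule_tac Lim_null_comparison) auto
  then have lim: "(\<lambda>n. W (u n)) \<longlonglongrightarrow> y"
    using LIM_zero_iff by blast
  have size: "form_norm W (u n) \<le> form_norm W x + e n" for n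
  proof -
    define d where "d = x - u n"
    have "d \<in> S"
      using complex_vector.subspace_neg[OF S uS[of n]] by (simp add: d_def)
    then have "cinner y d = 0"
      using y by (simp add: projects_to_def corthogonal_def)
    then have "cmod (cinner (W (u n)) d) \<le> e n * form_norm W d"
      using dual[of n d] by (simp add: cinner_diff_left)
    then have "- (e n * form_norm W d) \<le> Re (cinner (W (u n)) d)"
      using abs_Re_le_cmod[of "cinner (W (u n)) d"] by linarith
    moreover have "(form_norm W x)\<^sup>2
        = (form_norm W (u n))\<^sup>2 + 2 * Re (cinner (W (u n)) d) + (form_norm W d)\<^sup>2"
      using form_norm_add_square[OF W, of "u n" d] by (simp add: d_def)
    \<comment> \<open>completing the square absorbs the cross term \<open>2 * e n * form_norm W d\<close> into \<open>(e n)\<^sup>2\<close>\<close>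
    moreover have "0 \<le> (form_norm W d - e n)\<^sup>2"
      by simp
    moreover have "0 \<le> form_norm W x * e n"
      using form_norm_nonneg[OF W, of x] epos[of n] by simp
    ultimately have "(form_norm W (u n))\<^sup>2 \<le> (form_norm W x + e n)\<^sup>2"
      by (simp add: power2_eq_square algebra_simps)
    then show ?thesis
      by (rule power2_le_imp_le) (use form_norm_nonneg[OF W, of x] epos[of n] in simp)
  qed
  show ?thesis
    using that[of u] uS lim size dual unfolding e_def by blast
qed

text \<open>The projection does not increase length. For \<open>z = x\<close> this is the inequality between the quadratic
forms of the shorted operator and of \<open>W\<close>; for general \<open>z\<close> it yields boundedness.\<close>

lemma projects_to_dominated:
  assumes W: "positive_op W" and S: "csubspace S" and y: "projects_to W S x y"
  shows "cmod (cinner y z) \<le> form_norm W x * form_norm W z"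
proof -
  obtain u where u: "(\<lambda>n. W (u n)) \<longlonglongrightarrow> y"
    "\<And>n. form_norm W (u n) \<le> form_norm W x + inverse (real (Suc n))"
    using projects_to_sequence[OF assms] by metis
  have "(\<lambda>n. cmod (cinner (W (u n)) z)) \<longlonglongrightarrow> cmod (cinner y z)"
    by (intro tendsto_norm tendsto_cinner_left u)
  moreover have "(\<lambda>n. (form_norm W x + inverse (real (Suc n))) * form_norm W z)
      \<longlonglongrightarrow> (form_norm W x + 0) * form_norm W z"
    by (intro tendsto_mult tendsto_add tendsto_const LIMSEQ_inverse_real_of_nat)
  moreover have "cmod (cinner (W (u n)) z) \<le> (form_norm W x + inverse (real (Suc n))) * form_norm W z" for n
    by (rule order_trans[OF form_Cauchy_Schwarz[OF W] mult_right_mono[OF u(2) form_norm_nonneg[OF W]]])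
  ultimately have "cmod (cinner y z) \<le> (form_norm W x + 0) * form_norm W z"
    by (intro LIMSEQ_le) auto
  then show ?thesis
    by simp
qed

text \<open>Any competitor \<open>X\<close> vanishes on \<open>S\<close>, so its quadratic form is constant on \<open>x + S\<close>, where it lies below
that of \<open>W\<close>. Along the minimizing sequence the form of \<open>W\<close> converges to \<open>\<langle>y, x\<rangle>\<close>. With \<open>X = 0\<close> this also
shows that \<open>y\<close> depends positively on \<open>x\<close>.\<close>

lemma projects_to_maximal:
  assumes W: "positive_op W" and S: "csubspace S" and y: "projects_to W S x y"
    and X: "positive_op X" and le: "loewner_le X W" and ran: "range X \<subseteq> corthogonal S"
  shows "cinner y x - cinner (X x) x \<in> \<real>\<^sub>\<ge>\<^sub>0"
proof -
  note Xb = positive_op_bounded[OF X]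
  obtain u where u: "\<And>n. u n - x \<in> S"
    "\<And>n. form_norm W (u n) \<le> form_norm W x + inverse (real (Suc n))"
    "\<And>n z. cmod (cinner (W (u n) - y) z) \<le> inverse (real (Suc n)) * form_norm W z"
    using projects_to_sequence[OF W S y] by metis
  have "X d = 0" if "d \<in> S" for d
  proof (rule cinner_ext)
    fix z
    have "cinner (X z) d = 0"
      using ran that by (auto simp: corthogonal_def)
    then show "cinner (X d) z = cinner 0 z"
      using cinner_commute[of d "X z"] by (simp add: positive_op_hermitian[OF X])
  qed
  then have Xu: "X (u n) = X x" for n
    using bounded_clinear_zero_diff(2)[OF Xb] u(1) by (metis eq_iff_diff_eq_0)
  have "cinner (X x) (u n - x) = 0" for n
    using ran u(1)[of n] by (auto simp: corthogonal_def)
  then have Xq: "cinner (X (u n)) (u n) = cinner (X x) x" for n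
    by (simp add: Xu cinner_diff_right)
  have "cinner y (u n - x) = 0" for n
    using y u(1)[of n] by (auto simp: projects_to_def corthogonal_def)
  then have yq: "cinner y (u n) = cinner y x" for n
    by (simp add: cinner_diff_right)
  have "(\<lambda>n. cinner (W (u n)) (u n) - cinner y x) \<longlonglongrightarrow> 0"
  proof (rule Lim_null_comparison)
    have "norm (cinner (W (u n)) (u n) - cinner y x)
      \<le> inverse (real (Suc n)) * (form_norm W x + inverse (real (Suc n)))" for n
    proof -
      have "norm (cinner (W (u n)) (u n) - cinner y x) = cmod (cinner (W (u n) - y) (u n))"
        by (simp add: cinner_diff_left yq)
      also have "\<dots> \<le> inverse (real (Suc n)) * form_norm W (u n)"
        by (rule u(3))
      also have "\<dots> \<le> inverse (real (Suc n)) * (form_norm W x + inverse (real (Suc n)))"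
        by (rule mult_left_mono[OF u(2)]) simp
      finally show ?thesis .
    qed
    then show "\<forall>\<^sub>F n in sequentially. norm (cinner (W (u n)) (u n) - cinner y x)
      \<le> inverse (real (Suc n)) * (form_norm W x + inverse (real (Suc n)))"
      by simp
    have "(\<lambda>n. inverse (real (Suc n)) * (form_norm W x + inverse (real (Suc n))))
      \<longlonglongrightarrow> 0 * (form_norm W x + 0)"
      by (intro tendsto_mult tendsto_add tendsto_const LIMSEQ_inverse_real_of_nat)
    then show "(\<lambda>n. inverse (real (Suc n)) * (form_norm W x + inverse (real (Suc n)))) \<longlonglongrightarrow> 0"
      by simp
  qed
  then have "(\<lambda>n. cinner (W (u n)) (u n)) \<longlonglongrightarrow> cinner y x"
    using LIM_zero_iff by blast
  then have lim: "(\<lambda>n. cinner (W (u n)) (u n) - cinner (X x) x) \<longlonglongrightarrow> cinner y x - cinner (X x) x"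
    by (intro tendsto_diff tendsto_const)
  moreover have "cinner (W (u n)) (u n) - cinner (X x) x \<in> \<real>\<^sub>\<ge>\<^sub>0" for n
    using le unfolding loewner_le_def positive_op_def by (metis Xq cinner_diff_left)
  ultimately show ?thesis
    by (rule_tac closed_sequentially[OF closed_nonneg_Reals_complex])
qed

definition form_projection :: "('a::complex_inner \<Rightarrow> 'a) \<Rightarrow> 'a set \<Rightarrow> 'a \<Rightarrow> 'a" where
  "form_projection W S x = (THE y. projects_to W S x y)"

lemma projects_to_form_projection:
  fixes W :: "'a::chilbert_space \<Rightarrow> 'a"
  assumes W: "positive_op W" and S: "csubspace S"
  shows "projects_to W S x (form_projection W S x)"
  unfolding form_projection_def
  by (rule theI') (use projects_to_exists[OF W S] projects_to_unique[OF W S] in blast)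

lemma form_projection_bounded:
  fixes W :: "'a::chilbert_space \<Rightarrow> 'a"
  assumes W: "positive_op W" and S: "csubspace S"
  shows "bounded_clinear (form_projection W S)"
proof -
  note proj = projects_to_form_projection[OF W S]
  obtain K where K: "K > 0" "\<And>x. form_norm W x \<le> K * norm x"
    using form_norm_bounded[OF W] by blast
  obtain L where L: "L > 0"
    "\<And>y r. (\<And>z. cmod (cinner y z) \<le> r * form_norm W z) \<Longrightarrow> 0 \<le> r \<Longrightarrow> norm y \<le> r * L"
    using form_dual_bound_norm[OF W] by blast
  have "norm (form_projection W S x) \<le> norm x * (K * L)" for x
  proof -
    have "norm (form_projection W S x) \<le> form_norm W x * L"
      using projects_to_dominated[OF W S proj] form_norm_nonneg[OF W] by (rule L(2))
    also have "\<dots> \<le> (K * norm x) * L"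
      using K(2) L(1) by (intro mult_right_mono) auto
    finally show ?thesis
      by (simp add: mult_ac)
  qed
  moreover have "form_projection W S (x + y) = form_projection W S x + form_projection W S y" for x y
    by (rule projects_to_unique[OF W S proj projects_to_add[OF W S proj proj]])
  moreover have "form_projection W S (a *\<^sub>C x) = a *\<^sub>C form_projection W S x" for a x
    by (rule projects_to_unique[OF W S proj projects_to_scaleC[OF W S proj]])
  ultimately show ?thesis
    by (auto simp: bounded_clinear_iff)
qed

lemma loewner_le_antisym:
  assumes "loewner_le X Y" "loewner_le Y X"
  shows "X = Y"
proof -
  define D where "D x = Y x - X x" for x
  have pos: "positive_op D"
    using assms(1) by (simp add: loewner_le_def D_def[abs_def])
  have "form_norm D x = 0" for x
  proof -
    have "cinner (Y x - X x) x \<in> \<real>\<^sub>\<ge>\<^sub>0" "cinner (X x - Y x) x \<in> \<real>\<^sub>\<ge>\<^sub>0"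
      using assms by (simp_all add: loewner_le_def positive_op_def)
    then show ?thesis
      by (simp add: form_norm_def D_def complex_nonneg_Reals_iff cinner_diff_left)
  qed
  then have "cinner (D x) z = cinner 0 z" for x z
    using form_Cauchy_Schwarz[OF pos, of x z] by simp
  then have "D x = 0" for x
    by (rule cinner_ext)
  then show ?thesis
    by (simp add: D_def fun_eq_iff)
qed

lemma shorted_is_form_projection:
  fixes W :: "'a::chilbert_space \<Rightarrow> 'a"
  assumes W: "positive_op W" and S: "csubspace S"
  shows "is_maximum loewner_le
     {X. bounded_clinear X \<and> loewner_le (\<lambda>_. 0) X \<and> loewner_le X W \<and>
         range X \<subseteq> corthogonal S} (form_projection W S)" (is "is_maximum _ ?A ?Z")
    and "shorted W S = form_projection W S"
proof -
  note proj = projects_to_form_projection[OF W S]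
  note Zb = form_projection_bounded[OF W S]
  have above: "loewner_le X ?Z" if "positive_op X" "loewner_le X W" "range X \<subseteq> corthogonal S" for X
    using projects_to_maximal[OF W S proj that] bounded_clinear_diff[OF Zb positive_op_bounded[OF that(1)]]
    by (simp add: loewner_le_def positive_op_def cinner_diff_left)
  have "positive_op (\<lambda>x. 0)"
    by (simp add: positive_op_def bounded_clinear_zero)
  then have Zpos: "loewner_le (\<lambda>_. 0) ?Z"
    by (rule above) (use W in \<open>auto simp: loewner_le_def corthogonal_def\<close>)
  have ZW: "loewner_le ?Z W"
  proof -
    have "cinner (W x - ?Z x) x \<in> \<real>\<^sub>\<ge>\<^sub>0" for x
    proof -
      have "cinner (?Z x) x \<in> \<real>\<^sub>\<ge>\<^sub>0"
        using Zpos by (simp add: loewner_le_def positive_op_def)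
      moreover have "Re (cinner (?Z x) x) \<le> (form_norm W x)\<^sup>2"
        using complex_Re_le_cmod[of "cinner (?Z x) x"] projects_to_dominated[OF W S proj, of x x]
        by (simp add: power2_eq_square)
      ultimately show ?thesis
        by (simp add: cinner_diff_left cinner_form[OF W] complex_nonneg_Reals_iff)
    qed
    then show ?thesis
      by (simp add: loewner_le_def positive_op_def bounded_clinear_diff Zb positive_op_bounded[OF W])
  qed
  show max: "is_maximum loewner_le ?A ?Z"
    using Zb Zpos ZW proj above
    by (auto simp: is_maximum_def projects_to_def loewner_le_def)
  show "shorted W S = ?Z"
    unfolding shorted_def
    using max by (intro the_equality) (auto simp: is_maximum_def intro: loewner_le_antisym)
qed

lemma shorted_feasible:
  fixes W :: "'a::chilbert_space \<Rightarrow> 'a"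
  assumes W: "positive_op W" and S: "csubspace S"
  shows "positive_op (shorted W S)" "loewner_le (shorted W S) W"
    "range (shorted W S) \<subseteq> corthogonal S"
  using shorted_is_form_projection[OF W S] by (auto simp: is_maximum_def loewner_le_def)

lemma shorted_greatest:
  fixes W :: "'a::chilbert_space \<Rightarrow> 'a"
  assumes W: "positive_op W" and S: "csubspace S"
    and "positive_op X" "loewner_le X W" "range X \<subseteq> corthogonal S"
  shows "loewner_le X (shorted W S)"
  using shorted_is_form_projection[OF W S] assms(3-)
  by (auto simp: is_maximum_def loewner_le_def positive_op_bounded)

text \<open>The description of the shorted operator on which the treatment of the minus order rests.\<close>

lemma shorted_limit:
  fixes W :: "'a::chilbert_space \<Rightarrow> 'a"
  assumes W: "positive_op W" and S: "csubspace S"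
  obtains u where "\<And>n. u n - x \<in> S" "(\<lambda>n. W (u n)) \<longlonglongrightarrow> shorted W S x"
proof (rule projects_to_sequence[OF W S projects_to_form_projection[OF W S]])
  fix u
  assume "\<And>n. u n - x \<in> S" "(\<lambda>n. W (u n)) \<longlonglongrightarrow> form_projection W S x"
  then show thesis
    by (intro that) (simp_all add: shorted_is_form_projection(2)[OF W S])
qed

section \<open>Orthogonal projections and adjoints\<close>

text \<open>For the identity operator the seminorm is the norm, so the identity shorted to \<open>K\<close> is the orthogonal
projection onto the complement of \<open>K\<close>.\<close>

lemma orthogonal_projection_exists:
  fixes K :: "'a::chilbert_space set"
  assumes K: "csubspace K" "closed K"
  obtains p where "bounded_clinear p" "\<And>x. p x \<in> K" "\<And>x. x \<in> K \<Longrightarrow> p x = x"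
    "\<And>x. x - p x \<in> corthogonal K"
proof -
  define Z where "Z = shorted (\<lambda>x::'a. x) K"
  note pos = shorted_feasible[OF positive_op_id K(1), folded Z_def]
  have mem: "x - Z x \<in> K" for x
  proof -
    obtain u where u: "\<And>n. u n - x \<in> K" "u \<longlonglongrightarrow> Z x"
      using shorted_limit[OF positive_op_id K(1)] unfolding Z_def by metis
    have "(\<lambda>n. x - u n) \<longlonglongrightarrow> x - Z x"
      by (intro tendsto_diff tendsto_const u)
    moreover have "x - u n \<in> K" for n
      using complex_vector.subspace_neg[OF K(1) u(1)[of n]] by simp
    ultimately show ?thesis
      by (rule_tac closed_sequentially[OF K(2)])
  qed
  show ?thesis
  proof (rule that[of "\<lambda>x. x - Z x"])
    show "bounded_clinear (\<lambda>x. x - Z x)"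
      by (intro bounded_clinear_diff bounded_clinear_id positive_op_bounded pos)
    show "x - Z x \<in> K" "x - (x - Z x) \<in> corthogonal K" for x
      using mem pos(3) by auto
    show "x - Z x = x" if "x \<in> K" for x
    proof -
      have "Z x \<in> K"
        using complex_vector.subspace_diff[OF K(1) that mem[of x]] by simp
      then have "cinner (Z x) (Z x) = 0"
        using pos(3) by (auto simp: corthogonal_def)
      then show ?thesis
        by (simp add: cinner_eq_zero_iff)
    qed
  qed
qed

lemma adjoint_exists:
  fixes T :: "'a::chilbert_space \<Rightarrow> 'a"
  assumes T: "bounded_clinear T"
  shows "\<exists>T'. bounded_clinear T' \<and> (\<forall>x y. cinner (T x) y = cinner x (T' y))"
proof -
  \<comment> \<open>the Riesz representation of the functional \<open>x \<mapsto> \<langle>T x, y\<rangle>\<close>, from a vector orthogonal to its kernel\<close>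
  have riesz: "\<exists>w. \<forall>x. cinner (T x) y = cinner x w" for y
  proof -
    define N where "N = {x. cinner (T x) y = 0}"
    have sub: "csubspace N"
      by (rule complex_vector.subspaceI)
        (auto simp: N_def bounded_clinearD[OF T] bounded_clinear_zero_diff[OF T]
          cinner_add_left cinner_scaleC_left)
    have "continuous_on UNIV (\<lambda>x. cinner (T x) y)"
      by (rule linear_continuous_on
          [OF bounded_linear_compose[OF bounded_linear_cinner_left bounded_clinearD(3)[OF T]]])
    then have "closed N"
      unfolding N_def by (rule closed_Collect_eq) (rule continuous_on_const)
    then obtain p where p: "\<And>x. p x \<in> N" "\<And>x. x - p x \<in> corthogonal N"
      using orthogonal_projection_exists[OF sub] by metis
    show ?thesis
    proof (cases "N = UNIV")
      case True
      then show ?thesis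
        by (intro exI[of _ 0]) (auto simp: N_def)
    next
      case False
      then obtain x0 where "x0 \<notin> N"
        by blast
      define z where "z = x0 - p x0"
      define f where "f x = cinner (T x) y" for x
      have zN: "z \<in> corthogonal N"
        using p(2) by (simp add: z_def)
      have "f z \<noteq> 0"
        using \<open>x0 \<notin> N\<close> p(1)[of x0]
        by (simp add: N_def f_def z_def bounded_clinear_zero_diff[OF T] cinner_diff_left)
      then have "z \<noteq> 0"
        by (auto simp: f_def bounded_clinear_zero_diff[OF T])
      have "f x = cinner x (cnj (f z / cinner z z) *\<^sub>C z)" for x
      proof -
        have "x - (f x / f z) *\<^sub>C z \<in> N"
          using \<open>f z \<noteq> 0\<close> unfolding f_def
          by (simp add: N_def bounded_clinearD[OF T] bounded_clinear_zero_diff[OF T]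
              cinner_diff_left cinner_scaleC_left)
        then have "cinner z (x - (f x / f z) *\<^sub>C z) = 0"
          using zN by (simp add: corthogonal_def)
        then have "cinner (x - (f x / f z) *\<^sub>C z) z = 0"
          using cinner_commute[of "x - (f x / f z) *\<^sub>C z" z] by simp
        then have "cinner x z = f x / f z * cinner z z"
          by (simp add: cinner_diff_left cinner_scaleC_left)
        then show ?thesis
          using \<open>f z \<noteq> 0\<close> \<open>z \<noteq> 0\<close> by (simp add: cinner_scaleC_right cinner_eq_zero_iff)
      qed
      then show ?thesis
        unfolding f_def by blast
    qed
  qed
  then obtain T' where T': "\<And>x y. cinner (T x) y = cinner x (T' y)"
    by metis
  obtain K where K: "K > 0" "\<And>x. norm (T x) \<le> norm x * K"
    using bounded_linear.pos_bounded[OF bounded_clinearD(3)[OF T]] by blast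
  have "norm (T' y) \<le> norm y * K" for y
  proof (cases "T' y = 0")
    case False
    have "norm (T' y) * norm (T' y) = cmod (cinner (T (T' y)) y)"
      by (simp add: T' cinner_self power2_eq_square norm_mult)
    also have "\<dots> \<le> norm (T (T' y)) * norm y"
      by (rule cinner_Cauchy_Schwarz)
    also have "\<dots> \<le> (norm (T' y) * K) * norm y"
      by (rule mult_right_mono[OF K(2)]) simp
    finally have "norm (T' y) * norm (T' y) \<le> norm (T' y) * (norm y * K)"
      by (simp add: mult_ac)
    then show ?thesis
      using False by simp
  qed (use K(1) in simp)
  moreover have "T' (x + y) = T' x + T' y" for x y
    by (rule cinner_ext_right) (simp add: cinner_add_right flip: T')
  moreover have "T' (a *\<^sub>C x) = a *\<^sub>C T' x" for a x
    by (rule cinner_ext_right) (simp add: cinner_scaleC_right flip: T')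
  ultimately have "bounded_clinear T'"
    by (auto simp: bounded_clinear_iff)
  with T' show ?thesis
    by blast
qed

lemma cadjoint_eqI:
  assumes "bounded_clinear T'" "\<And>x y. cinner (T x) y = cinner x (T' y)"
  shows "cadjoint T = T'"
  unfolding cadjoint_def
proof (rule the_equality)
  fix U assume U: "bounded_clinear U \<and> (\<forall>x y. cinner (T x) y = cinner x (U y))"
  show "U = T'"
  proof
    show "U y = T' y" for y
      by (rule cinner_ext_right) (use U assms(2) in auto)
  qed
qed (use assms in blast)

lemma cadjoint:
  assumes "bounded_clinear T"
  shows "bounded_clinear (cadjoint T)" "cinner (T x) y = cinner x (cadjoint T y)"
proof -
  obtain T' where T': "bounded_clinear T'" "\<And>x y. cinner (T x) y = cinner x (T' y)"
    using adjoint_exists[OF assms] by blast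
  then have "cadjoint T = T'"
    by (rule cadjoint_eqI)
  with T' show "bounded_clinear (cadjoint T)" "cinner (T x) y = cinner x (cadjoint T y)"
    by auto
qed

lemma cadjoint_right:
  assumes "bounded_clinear T"
  shows "cinner x (T y) = cinner (cadjoint T x) y"
  using cadjoint(2)[OF assms, of y x] cinner_commute[of x "T y"] cinner_commute[of y "cadjoint T x"]
  by simp

lemma cadjoint_cadjoint: "bounded_clinear T \<Longrightarrow> cadjoint (cadjoint T) = T"
  by (rule cadjoint_eqI[OF _ cadjoint_right[symmetric]])

lemma cadjoint_positive: "positive_op W \<Longrightarrow> cadjoint W = W"
  by (rule cadjoint_eqI[OF positive_op_bounded positive_op_hermitian])

lemma cadjoint_compose:
  assumes "bounded_clinear T" "bounded_clinear U"
  shows "cadjoint (T \<circ> U) = cadjoint U \<circ> cadjoint T"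
proof (rule cadjoint_eqI)
  show "bounded_clinear (cadjoint U \<circ> cadjoint T)"
    unfolding comp_def by (rule bounded_clinear_compose[OF cadjoint(1)[OF assms(2)] cadjoint(1)[OF assms(1)]])
  show "cinner ((T \<circ> U) x) y = cinner x ((cadjoint U \<circ> cadjoint T) y)" for x y
    unfolding comp_def by (simp only: cadjoint(2)[OF assms(1)] cadjoint(2)[OF assms(2)])
qed

lemma bounded_projection_cadjoint:
  assumes "bounded_projection P"
  shows "bounded_projection (cadjoint P)"
  using assms cadjoint_compose[of P P] cadjoint(1)[of P] by (simp add: bounded_projection_def)

lemma bounded_projection_complement:
  assumes "bounded_projection P"
  shows "bounded_projection (\<lambda>x. x - P x)"
proof -
  have Pb: "bounded_clinear P" and P: "P (P x) = P x" for x
    using assms by (auto simp: bounded_projection_def fun_eq_iff)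
  show ?thesis
    by (auto simp: bounded_projection_def fun_eq_iff P bounded_clinear_zero_diff[OF Pb]
        intro: bounded_clinear_diff bounded_clinear_id Pb)
qed

lemma vanishes_if_cadjoint_range_orthogonal:
  assumes "bounded_clinear X" "range (cadjoint X) \<subseteq> corthogonal S" "s \<in> S"
  shows "X s = 0"
proof (rule cinner_ext)
  fix z
  have "cinner (cadjoint X z) s = 0"
    using assms by (auto simp: corthogonal_def)
  then show "cinner (X s) z = cinner 0 z"
    using cadjoint(2)[OF assms(1), of s z] cinner_commute[of s "cadjoint X z"] by simp
qed

section \<open>Minus order and compatibility\<close>

text \<open>Since \<open>X\<close> is constant on \<open>x + S\<close>, \<open>X x = P (W (u n))\<close> along the sequence in \<open>x + S\<close> whose image under
\<open>W\<close> converges to the shorted operator at \<open>x\<close>.\<close>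

lemma factor_through_shorted:
  fixes W :: "'a::chilbert_space \<Rightarrow> 'a"
  assumes W: "positive_op W" and S: "csubspace S"
    and P: "bounded_clinear P" and X: "bounded_clinear X" "X = P \<circ> W"
    and zero: "\<And>s. s \<in> S \<Longrightarrow> X s = 0"
  shows "X = P \<circ> shorted W S"
proof
  fix x
  obtain u where u: "\<And>n. u n - x \<in> S" "(\<lambda>n. W (u n)) \<longlonglongrightarrow> shorted W S x"
    using shorted_limit[OF W S] by metis
  have "P (W (u n)) = X x" for n
  proof -
    have "X (u n) - X x = 0"
      using zero[OF u(1)[of n]] by (simp add: bounded_clinear_zero_diff(2)[OF X(1)])
    then show ?thesis
      by (simp add: X(2))
  qed
  then have "(\<lambda>n. X x) \<longlonglongrightarrow> P (shorted W S x)"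
    using bounded_linear.tendsto[OF bounded_clinearD(3)[OF P] u(2)] by simp
  then show "X x = (P \<circ> shorted W S) x"
    using LIMSEQ_unique[OF tendsto_const] by simp
qed

text \<open>The two projections that witness \<open>X\<close> below \<open>W\<close> also witness \<open>X\<close> below the shorted operator, because
\<open>X\<close> and its adjoint both vanish on \<open>S\<close>.\<close>

lemma minus_set_le_shorted:
  fixes W :: "'a::chilbert_space \<Rightarrow> 'a"
  assumes W: "positive_op W" and S: "csubspace S" and X: "X \<in> minus_set W S"
  shows "minus_le X (shorted W S)"
proof -
  from X have Xb: "bounded_clinear X" and le: "minus_le X W"
    and ran: "range X \<subseteq> corthogonal S" and ran': "range (cadjoint X) \<subseteq> corthogonal S"
    by (auto simp: minus_set_def)
  from le obtain P Q where PQ: "bounded_projection P" "bounded_projection Q"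
    and XP: "X = P \<circ> W" and XQ: "cadjoint X = Q \<circ> W"
    unfolding minus_le_def cadjoint_positive[OF W] by blast
  have bd: "bounded_clinear P" "bounded_clinear Q"
    using PQ by (auto simp: bounded_projection_def)
  have "X = P \<circ> shorted W S" "cadjoint X = Q \<circ> shorted W S"
    using vanishes_if_cadjoint_range_orthogonal[of X S] vanishes_if_cadjoint_range_orthogonal[of "cadjoint X" S]
      ran ran' Xb cadjoint(1)[OF Xb] cadjoint_cadjoint[OF Xb]
    by (auto intro!: factor_through_shorted[OF W S] bd XP XQ)
  then show ?thesis
    using PQ unfolding minus_le_def cadjoint_positive[OF shorted_feasible(1)[OF W S]] by blast
qed

lemma shorted_maximum_minus_set_iff:
  fixes W :: "'a::chilbert_space \<Rightarrow> 'a"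
  assumes W: "positive_op W" and S: "csubspace S"
  shows "is_maximum minus_le (minus_set W S) (shorted W S) \<longleftrightarrow> minus_le (shorted W S) W"
proof -
  note Z = shorted_feasible[OF W S]
  have "shorted W S \<in> minus_set W S \<longleftrightarrow> minus_le (shorted W S) W"
    by (simp add: minus_set_def cadjoint_positive[OF Z(1)] positive_op_bounded[OF Z(1)] Z(3))
  then show ?thesis
    using minus_set_le_shorted[OF W S] by (auto simp: is_maximum_def)
qed

text \<open>For self-adjoint operators one projection suffices: taking the adjoint of \<open>Z = P W\<close> gives
\<open>Z = W P\<^sup>*\<close>.\<close>

lemma minus_le_positive_iff:
  fixes W :: "'a::chilbert_space \<Rightarrow> 'a"
  assumes W: "positive_op W" and Z: "positive_op Z"
  shows "minus_le Z W \<longleftrightarrow> (\<exists>E. bounded_projection E \<and> Z = W \<circ> E \<and> Z = cadjoint E \<circ> W)"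
proof
  assume "minus_le Z W"
  then obtain P where P: "bounded_projection P" "Z = P \<circ> W"
    unfolding minus_le_def by blast
  then have Pb: "bounded_clinear P"
    by (simp add: bounded_projection_def)
  have "Z = W \<circ> cadjoint P"
    using cadjoint_compose[OF Pb positive_op_bounded[OF W]]
    by (simp add: P(2)[symmetric] cadjoint_positive W Z)
  then show "\<exists>E. bounded_projection E \<and> Z = W \<circ> E \<and> Z = cadjoint E \<circ> W"
    using P cadjoint_cadjoint[OF Pb] bounded_projection_cadjoint[OF P(1)]
    by (intro exI[of _ "cadjoint P"]) simp
next
  assume "\<exists>E. bounded_projection E \<and> Z = W \<circ> E \<and> Z = cadjoint E \<circ> W"
  then show "minus_le Z W"
    unfolding minus_le_def cadjoint_positive[OF W] cadjoint_positive[OF Z]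
    using bounded_projection_cadjoint by blast
qed

text \<open>The nullspace of \<open>W E\<close> is the direct sum of the nullspace of \<open>E\<close> and of the intersection \<open>K\<close> of the
range of \<open>E\<close> with the nullspace of \<open>W\<close>. The projection \<open>I - E\<close> is symmetric for \<open>W\<close> and has the first
summand as range; adding a projection onto \<open>K\<close> enlarges the range, and \<open>W\<close> does not see the addition.\<close>

lemma compatible_nullspace_if_symmetric_projection:
  fixes W :: "'a::chilbert_space \<Rightarrow> 'a"
  assumes W: "positive_op W" and E: "bounded_projection E"
    and sym: "W \<circ> E = cadjoint E \<circ> W"
  shows "compatible W (nullspace (W \<circ> E))"
proof -
  note Wb = positive_op_bounded[OF W]
  have Eb: "bounded_clinear E" and EE: "E (E x) = E x" for x
    using E by (auto simp: bounded_projection_def fun_eq_iff)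
  define K where "K = {x. E x = x \<and> W x = 0}"
  have K_sub: "csubspace K"
    by (rule complex_vector.subspaceI)
      (auto simp: K_def bounded_clinearD[OF Wb] bounded_clinear_zero_diff[OF Wb]
        bounded_clinearD[OF Eb] bounded_clinear_zero_diff[OF Eb])
  have "closed {x. E x = x}" "closed {x. W x = 0}"
    using linear_continuous_on[OF bounded_clinearD(3)[OF Eb]] linear_continuous_on[OF bounded_clinearD(3)[OF Wb]]
    by (auto intro: closed_Collect_eq continuous_on_id continuous_on_const)
  then have K_closed: "closed K"
    unfolding K_def Collect_conj_eq by (rule closed_Int)
  obtain p where p: "bounded_clinear p" "\<And>x. p x \<in> K" "\<And>x. x \<in> K \<Longrightarrow> p x = x"
    using orthogonal_projection_exists[OF K_sub K_closed] by metis
  define Q where "Q x = (x - E x) + p (E x)" for x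
  have Qb: "bounded_clinear Q"
    unfolding Q_def
    by (intro bounded_clinear_add bounded_clinear_diff bounded_clinear_id Eb
        bounded_clinear_compose[OF p(1) Eb])
  have Wp: "W (p x) = 0" and Ep: "E (p x) = p x" for x
    using p(2)[of x] by (auto simp: K_def)
  have EQ: "E (Q x) = p (E x)" for x
    by (simp add: Q_def bounded_clinearD[OF Eb] bounded_clinear_zero_diff[OF Eb] EE Ep)
  have into: "Q x \<in> nullspace (W \<circ> E)" for x
    by (simp add: nullspace_def EQ Wp)
  have fixed: "Q x = x" if "x \<in> nullspace (W \<circ> E)" for x
    using that p(3)[of "E x"] by (simp add: nullspace_def Q_def K_def EE)
  have WQ: "W (Q x) = W x - W (E x)" for x
    by (simp add: Q_def bounded_clinearD[OF Wb] bounded_clinear_zero_diff[OF Wb] Wp)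
  have "W (Q y) = cadjoint Q (W y)" for y
  proof (rule cinner_ext_right)
    fix x
    have "W (E y) = cadjoint E (W y)"
      using fun_cong[OF sym, of y] by simp
    then have "cinner x (W (E y)) = cinner (W (E x)) y"
      by (simp only: cadjoint(2)[OF Eb, symmetric] positive_op_hermitian[OF W])
    then have "cinner x (W (Q y)) = cinner (W (Q x)) y"
      by (simp add: WQ cinner_diff_right cinner_diff_left positive_op_hermitian[OF W])
    then show "cinner x (W (Q y)) = cinner x (cadjoint Q (W y))"
      by (simp only: cadjoint(2)[OF Qb, symmetric] positive_op_hermitian[OF W])
  qed
  moreover have "range Q = nullspace (W \<circ> E)"
    using into fixed[symmetric] by blast
  moreover have "bounded_projection Q"
    using Qb into fixed by (auto simp: bounded_projection_def)
  ultimately show ?thesis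
    unfolding compatible_def by (auto simp: fun_eq_iff)
qed

text \<open>A projection symmetric for \<open>W\<close> is orthogonal for the form of \<open>W\<close>, so \<open>W (I - Q)\<close> has the quadratic form
\<open>x \<mapsto> \<langle>W (x - Q x), x - Q x\<rangle>\<close>. It is a competitor in the definition of the shorted operator, hence below
it. Conversely the shorted operator vanishes on the range of \<open>Q\<close>, so its quadratic form too depends only
on \<open>x - Q x\<close>, and there it is dominated by that of \<open>W\<close>.\<close>

lemma shorted_if_compatible:
  fixes W :: "'a::chilbert_space \<Rightarrow> 'a"
  assumes W: "positive_op W" and S: "csubspace S"
    and Q: "bounded_projection Q" and ran: "range Q = nullspace (shorted W S)"
    and sym: "W \<circ> Q = cadjoint Q \<circ> W"
  shows "shorted W S x = W (x - Q x)"
proof -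
  define Z where "Z = shorted W S"
  define X where "X x = W (x - Q x)" for x
  note Z = shorted_feasible[OF W S, folded Z_def]
  note Wb = positive_op_bounded[OF W]
  have Qb: "bounded_clinear Q" and QQ: "Q (Q x) = Q x" for x
    using Q by (auto simp: bounded_projection_def fun_eq_iff)
  have WQ: "cinner (W (Q x)) y = cinner (W x) (Q y)" for x y
    using fun_cong[OF sym, of x] by (simp add: cadjoint_right[OF Qb])
  have ZQ: "Z (Q x) = 0" for x
    using ran by (auto simp: nullspace_def Z_def)
  have Qfix: "Q x = x" if "Z x = 0" for x
  proof -
    have "x \<in> range Q"
      using that ran by (simp add: nullspace_def Z_def)
    then show ?thesis
      using QQ by auto
  qed
  have Xq: "cinner (X x) x = cinner (W (x - Q x)) (x - Q x)" for x
    by (simp add: X_def bounded_clinear_zero_diff[OF Wb] cinner_diff_left cinner_diff_right WQ QQ)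
  have Zq: "cinner (Z x) x = cinner (Z (x - Q x)) (x - Q x)" for x
    using positive_op_hermitian[OF Z(1), of x "Q x"]
    by (simp add: bounded_clinear_zero_diff[OF positive_op_bounded[OF Z(1)]] cinner_diff_right ZQ)
  have Xb: "bounded_clinear X"
    unfolding X_def by (intro bounded_clinear_compose[OF Wb] bounded_clinear_diff bounded_clinear_id Qb)
  have Xpos: "positive_op X"
    using W Xb by (simp add: positive_op_def Xq)
  have "loewner_le X W"
  proof -
    have "W x - X x = W (Q x)" for x
      by (simp add: X_def bounded_clinear_zero_diff[OF Wb])
    moreover have "cinner (W (Q x)) x = cinner (W (Q x)) (Q x)" for x
      using WQ[of "Q x" x] by (simp add: QQ)
    ultimately show ?thesis
      using W bounded_clinear_diff[OF Wb Xb] by (simp add: loewner_le_def positive_op_def)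
  qed
  moreover have "range X \<subseteq> corthogonal S"
  proof -
    have "cinner (X x) s = 0" if "s \<in> S" for x s
    proof -
      have "Z s = 0"
      proof (rule cinner_ext)
        fix z
        have "cinner (Z z) s = 0"
          using Z(3) that by (auto simp: corthogonal_def)
        then show "cinner (Z s) z = cinner 0 z"
          using positive_op_hermitian[OF Z(1), of s z] cinner_commute[of s "Z z"] by simp
      qed
      then have "Q s = s"
        by (rule Qfix)
      then show ?thesis
        using WQ[of x s] by (simp add: X_def bounded_clinear_zero_diff[OF Wb] cinner_diff_left)
    qed
    then show ?thesis
      by (auto simp: corthogonal_def)
  qed
  ultimately have "loewner_le X Z"
    using shorted_greatest[OF W S Xpos] by (simp add: Z_def)
  moreover have "loewner_le Z X"
  proof -
    have "cinner (X x - Z x) x = cinner (W (x - Q x) - Z (x - Q x)) (x - Q x)" for x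
      by (simp only: cinner_diff_left[of "X x"] cinner_diff_left[of "W (x - Q x)"] Xq[of x] Zq[of x])
    then show ?thesis
      using Z(2) bounded_clinear_diff[OF Xb positive_op_bounded[OF Z(1)]]
      by (simp add: loewner_le_def positive_op_def)
  qed
  ultimately have "Z = X"
    using loewner_le_antisym by blast
  then show ?thesis
    by (simp add: Z_def X_def)
qed

theorem theorem3p9:
  fixes W :: "'a::chilbert_space \<Rightarrow> 'a" and S :: "'a set"
  assumes separable: "separable_space (euclidean :: 'a topology)"
    and W: "positive_op W"
    and S: "csubspace S" "closed S"
  shows "compatible W (nullspace (shorted W S)) \<longleftrightarrow>
         is_maximum minus_le (minus_set W S) (shorted W S)"
proof -
  define Z where "Z = shorted W S"
  have Z: "positive_op Z"
    using shorted_feasible[OF W S(1)] by (simp add: Z_def)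
  have "minus_le Z W" if compat: "compatible W (nullspace Z)"
  proof -
    from compat obtain Q where Q: "bounded_projection Q" "range Q = nullspace Z"
      and sym: "W \<circ> Q = cadjoint Q \<circ> W"
      unfolding compatible_def by blast
    define E where "E x = x - Q x" for x
    have E: "bounded_projection E"
      using bounded_projection_complement[OF Q(1)] by (simp add: E_def[abs_def])
    then have Eb: "bounded_clinear E"
      by (simp add: bounded_projection_def)
    have ZE: "Z = W \<circ> E"
      using shorted_if_compatible[OF W S(1) Q(1) _ sym] Q(2) by (simp add: Z_def E_def fun_eq_iff)
    then have "Z = cadjoint E \<circ> W"
      using cadjoint_compose[OF positive_op_bounded[OF W] Eb] by (metis W Z cadjoint_positive)
    with E ZE show ?thesis
      using minus_le_positive_iff[OF W Z] by blast
  qed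
  moreover have "compatible W (nullspace Z)" if le: "minus_le Z W"
    using le compatible_nullspace_if_symmetric_projection[OF W] minus_le_positive_iff[OF W Z] by metis
  ultimately show ?thesis
    unfolding shorted_maximum_minus_set_iff[OF W S(1)] by (auto simp: Z_def)
qed

end
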